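(* Let $X$ be a real Hilbert space, let $A$ and $B$ be maximally monotone operators on $X$, and let $w\in X$. Then for every $x\in X$, $$\big((-\operatorname{Id})\circ A^{-1}\circ(-\operatorname{Id})\big)(x-w)+\big(B^{-1}x-w\big)=D(x-w),\qquad\text{where } D\colon y\mapsto \Big(\big((-\operatorname{Id})\circ A^{-1}\circ(-\operatorname{Id})\big)y-w\Big)+B^{-1}(y+w).$$ Hence, with $C\colon x\mapsto \big((-\operatorname{Id})\circ A^{-1}\circ(-\operatorname{Id})\big)(x-w)+(B^{-1}x-w)$, one has $\operatorname{gra}C=(w,0)+\operatorname{gra}D$; that is, first taking the Attouch–Théra dual of $(A,B)$ and then perturbing by $w$ agrees, up to a horizontal shift of the graph of the sum by $w$, with first perturbing by $w$ and then taking the Attouch–Théra dual.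
   Context: Operators on $X$ may be set-valued. For an operator $A$, $(-\operatorname{Id})\circ A^{-1}\circ(-\operatorname{Id})=\big((-\operatorname{Id})\circ A\circ(-\operatorname{Id})\big)^{-1}$. The Attouch–Théra dual pair of $(A,B)$ is $(A,B)^*=\big((-\operatorname{Id})\circ A^{-1}\circ(-\operatorname{Id}),B^{-1}\big)$. The $w$-perturbation of a pair $(A,B)$ is the pair $(x\mapsto A(x-w),\;x\mapsto Bx-w)$. Thus the $w$-perturbation of the dual pair is $\big(x\mapsto \big((-\operatorname{Id})\circ A^{-1}\circ(-\operatorname{Id})\big)(x-w),\;x\mapsto B^{-1}x-w\big)$ and the dual of the $w$-perturbation is $\big(x\mapsto \big((-\operatorname{Id})\circ A^{-1}\circ(-\operatorname{Id})\big)x-w,\;x\mapsto B^{-1}(x+w)\big)$. *)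

theory Defs
  imports "HOL-Analysis.Analysis" "HOL-Library.Set_Algebras"
begin

text \<open>A set-valued operator on \<open>X\<close> is a function \<open>'a \<Rightarrow> 'a set\<close>. Sums of values \<open>S + T\<close> and
  translates \<open>p +o S\<close> are the Minkowski operations of \<^theory>\<open>HOL-Library.Set_Algebras\<close>;
  in particular \<open>S + {} = {}\<close>.\<close>

definition gra :: "('a \<Rightarrow> 'a set) \<Rightarrow> ('a \<times> 'a) set" where
  "gra A = {(x, u). u \<in> A x}"

definition inv_op :: "('a \<Rightarrow> 'a set) \<Rightarrow> ('a \<Rightarrow> 'a set)" where
  "inv_op A = (\<lambda>u. {x. u \<in> A x})"

definition monotone_op :: "('a::real_inner \<Rightarrow> 'a set) \<Rightarrow> bool" where
  "monotone_op A \<longleftrightarrow> (\<forall>(x, u) \<in> gra A. \<forall>(y, v) \<in> gra A. 0 \<le> (x - y) \<bullet> (u - v))"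

definition maximally_monotone :: "('a::real_inner \<Rightarrow> 'a set) \<Rightarrow> bool" where
  "maximally_monotone A \<longleftrightarrow>
     monotone_op A \<and> (\<forall>A'. monotone_op A' \<and> gra A \<subseteq> gra A' \<longrightarrow> gra A' = gra A)"

text \<open>\<open>(-Id) \<circ> A \<circ> (-Id)\<close>; the outer \<open>-Id\<close> acts on the values of \<open>A\<close>, which are sets.\<close>

definition neg_conj :: "('a::ab_group_add \<Rightarrow> 'a set) \<Rightarrow> ('a \<Rightarrow> 'a set)" where
  "neg_conj A = image uminus \<circ> A \<circ> uminus"

type_synonym 'a op_pair = "('a \<Rightarrow> 'a set) \<times> ('a \<Rightarrow> 'a set)"

fun AT_dual :: "'a::ab_group_add op_pair \<Rightarrow> 'a op_pair" where
  "AT_dual (A, B) = (neg_conj (inv_op A), inv_op B)"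

fun perturb :: "'a::ab_group_add \<Rightarrow> 'a op_pair \<Rightarrow> 'a op_pair" where
  "perturb w (A, B) = (\<lambda>x. A (x - w), \<lambda>x. (\<lambda>u. u - w) ` B x)"

fun pair_sum :: "'a::ab_group_add op_pair \<Rightarrow> ('a \<Rightarrow> 'a set)" where
  "pair_sum (A, B) = (\<lambda>x. A x + B x)"

end

theory Submission
  imports Defs
begin

text \<open>
  Perturbation by \<open>w\<close> shifts the arguments of \<open>A\<close> and the values of \<open>B\<close>, and inversion exchanges
  arguments and values. So dualising the perturbed pair shifts the values of the dual of \<open>A\<close> by
  \<open>-w\<close> (lemma \<open>neg_conj_inv_op_shift_arg\<close>; the two reflections turn the shift by \<open>w\<close> that
  inversion produces into one by \<open>-w\<close>) and the arguments of \<open>B\<inverse>\<close> (lemma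
  \<open>inv_op_shift_values\<close>). Perturbing the dual pair instead shifts the arguments of the first
  operator and the values of the second. The sum of the perturbed dual at \<open>x\<close> and the sum of the
  dual of the perturbation at \<open>x - w\<close> therefore involve the same two sets, with the shift by \<open>-w\<close>
  on one or the other summand; a Minkowski sum does not see the difference
  (lemma \<open>set_plus_shift_swap\<close>).
\<close>

lemma set_plus_shift_swap:
  fixes S T :: "'a::ab_group_add set"
  shows "S + (\<lambda>u. u - w) ` T = (\<lambda>u. u - w) ` S + T"
proof -
  have shift: "(\<lambda>u. u - w) ` U = (- w) +o U" for U :: "'a set"
    by (auto simp: elt_set_plus_def)
  show ?thesis
    by (simp add: shift set_plus_rearrange3 set_plus_rearrange4)
qed

lemma neg_conj_inv_op_shift_arg:
  "neg_conj (inv_op (\<lambda>x. A (x - w))) y = (\<lambda>u. u - w) ` neg_conj (inv_op A) y"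
proof -
  have inv: "inv_op (\<lambda>x. A (x - w)) u = (\<lambda>x. x + w) ` inv_op A u" for u
    by (force simp: inv_op_def image_iff intro: diff_add_cancel[symmetric])
  show ?thesis
    by (simp add: neg_conj_def inv image_image)
qed

lemma inv_op_shift_values:
  fixes B :: "'a::group_add \<Rightarrow> 'a set"
  shows "inv_op (\<lambda>x. (\<lambda>u. u - w) ` B x) y = inv_op B (y + w)"
  by (force simp: inv_op_def image_iff intro: add_diff_cancel[symmetric])

lemma gra_shift_arg:
  fixes F :: "'a::ab_group_add \<Rightarrow> 'a set"
  shows "gra (\<lambda>x. F (x - w)) = (w, 0) +o gra F"
  by (force simp: gra_def elt_set_plus_def intro: add_diff_cancel_left'[symmetric])

theorem mainTheorem5:
  fixes A B :: "'a::{real_inner, complete_space} \<Rightarrow> 'a set" and w :: 'a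
  assumes "maximally_monotone A" and "maximally_monotone B"
  shows
    "let C = (\<lambda>x. neg_conj (inv_op A) (x - w) + (\<lambda>u. u - w) ` inv_op B x);
         D = (\<lambda>y. (\<lambda>u. u - w) ` neg_conj (inv_op A) y + inv_op B (y + w))
     in (\<forall>x. neg_conj (inv_op A) (x - w) + (\<lambda>u. u - w) ` inv_op B x = D (x - w))
        \<and> gra C = (w, 0) +o gra D
        \<and> C = pair_sum (perturb w (AT_dual (A, B)))
        \<and> D = pair_sum (AT_dual (perturb w (A, B)))"
proof -
  define C where "C = (\<lambda>x. neg_conj (inv_op A) (x - w) + (\<lambda>u. u - w) ` inv_op B x)"
  define D where "D = (\<lambda>y. (\<lambda>u. u - w) ` neg_conj (inv_op A) y + inv_op B (y + w))"
  have C_eq: "C x = D (x - w)" for x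
    by (simp add: C_def D_def set_plus_shift_swap)
  then have "C = (\<lambda>x. D (x - w))" ..
  then have graph: "gra C = (w, 0) +o gra D"
    by (simp only: gra_shift_arg)
  have perturbed_dual: "C = pair_sum (perturb w (AT_dual (A, B)))"
    by (simp add: C_def)
  have dual_perturbed: "D = pair_sum (AT_dual (perturb w (A, B)))"
    by (simp add: D_def neg_conj_inv_op_shift_arg inv_op_shift_values)
  show ?thesis
    using C_eq graph perturbed_dual dual_perturbed
    unfolding Let_def C_def D_def by blast
qed

end
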